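(* Let $\mathcal D$ be universal, $\mathrm M=(M,d)\in\mathfrak U_{\mathcal D}$, $A,B\subseteq M$ finite with $A\cap B=\emptyset$, $s\in\mathbb N$, and for each $i<s$ let $\mathfrak t_i\subseteq\mathfrak s_i$ be Katětov functions of $\mathrm M$ with $\operatorname{dom}(\mathfrak t_i)=A$ and $\operatorname{dom}(\mathfrak s_i)=A\cup B$, such that $d(\mathfrak t_i,\mathfrak t_j)=d(\mathfrak s_i,\mathfrak s_j)$ for all $i,j<s$. Then there exists an isometric embedding $\alpha$ of $\mathrm M$ into $\mathrm M$ with $\alpha(x)=x$ for all $x\in A$ and $\alpha(x)\in\operatorname{orb}(\mathfrak s_i)$ for all $x\in\operatorname{orb}(\mathfrak t_i)$ and all $i<s$; equivalently $\operatorname{orb}_{\alpha(M)}(\mathfrak t_i)\subseteq\operatorname{orb}_{M}(\mathfrak s_i)$ for all $i<s$.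
   Context: $\mathcal D$ is a finite subset of $\mathbb R_{\ge0}$ containing $0$. $\mathfrak U_{\mathcal D}$ is the class of countable homogeneous metric spaces (every isometry between finite subspaces extends to an isometry of the space onto itself) with distance set exactly $\mathcal D$ into which every finite metric space with distances in $\mathcal D$ embeds isometrically; $\mathcal D$ is universal if this class is nonempty. A Katětov function of $\mathrm M$ is a map $\mathfrak t:F\to\mathcal D\setminus\{0\}$, $F\subseteq M$ finite, with $|\mathfrak t(x)-\mathfrak t(y)|\le d(x,y)\le\mathfrak t(x)+\mathfrak t(y)$ for all $x,y\in F$; $\operatorname{orb}_M(\mathfrak t)=\{y\in M\setminus F: d(y,x)=\mathfrak t(x)\ \forall x\in F\}$ and for $H\subseteq M$ containing $F$, $\operatorname{orb}_H(\mathfrak t)=\operatorname{orb}_M(\mathfrak t)\cap H$. $d(\mathfrak s,\mathfrak t)=\{d(x,y):x\in\operatorname{orb}_M(\mathfrak s),y\in\operatorname{orb}_M(\mathfrak t)\}$. *)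

theory Defs
  imports Complex_Main "HOL-Library.Countable_Set"
begin

definition metric_on :: "'a set \<Rightarrow> ('a \<Rightarrow> 'a \<Rightarrow> real) \<Rightarrow> bool" where
  "metric_on M d \<longleftrightarrow>
     (\<forall>x\<in>M. \<forall>y\<in>M. 0 \<le> d x y \<and> (d x y = 0 \<longleftrightarrow> x = y) \<and> d x y = d y x) \<and>
     (\<forall>x\<in>M. \<forall>y\<in>M. \<forall>z\<in>M. d x z \<le> d x y + d y z)"

definition dist_set :: "'a set \<Rightarrow> ('a \<Rightarrow> 'a \<Rightarrow> real) \<Rightarrow> real set" where
  "dist_set M d = {d x y | x y. x \<in> M \<and> y \<in> M}"

definition isometric_emb :: "'a set \<Rightarrow> ('a \<Rightarrow> 'a \<Rightarrow> real) \<Rightarrow> 'b set \<Rightarrow> ('b \<Rightarrow> 'b \<Rightarrow> real) \<Rightarrow> ('a \<Rightarrow> 'b) \<Rightarrow> bool" where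
  "isometric_emb M d N e f \<longleftrightarrow> f ` M \<subseteq> N \<and> (\<forall>x\<in>M. \<forall>y\<in>M. e (f x) (f y) = d x y)"

definition homogeneous :: "'a set \<Rightarrow> ('a \<Rightarrow> 'a \<Rightarrow> real) \<Rightarrow> bool" where
  "homogeneous M d \<longleftrightarrow>
     (\<forall>F G f. F \<subseteq> M \<and> G \<subseteq> M \<and> finite F \<and> bij_betw f F G \<and>
        (\<forall>x\<in>F. \<forall>y\<in>F. d (f x) (f y) = d x y) \<longrightarrow>
        (\<exists>g. bij_betw g M M \<and> (\<forall>x\<in>M. \<forall>y\<in>M. d (g x) (g y) = d x y) \<and> (\<forall>x\<in>F. g x = f x)))"

text \<open>Every finite metric space with distances in D embeds isometrically.  Every finite
  metric space is isometric to one whose carrier is a finite set of naturals, so it suffices to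
  quantify over those.\<close>
definition universal_for :: "real set \<Rightarrow> 'a set \<Rightarrow> ('a \<Rightarrow> 'a \<Rightarrow> real) \<Rightarrow> bool" where
  "universal_for D M d \<longleftrightarrow>
     (\<forall>(X::nat set) e. finite X \<and> metric_on X e \<and> dist_set X e \<subseteq> D \<longrightarrow>
        (\<exists>f. isometric_emb X e M d f))"

definition in_U :: "real set \<Rightarrow> 'a set \<Rightarrow> ('a \<Rightarrow> 'a \<Rightarrow> real) \<Rightarrow> bool" where
  "in_U D M d \<longleftrightarrow> countable M \<and> metric_on M d \<and> homogeneous M d \<and>
     dist_set M d = D \<and> universal_for D M d"

text \<open>D is universal iff U_D is nonempty (countable spaces can be taken on subsets of nat).\<close>
definition universal_dset :: "real set \<Rightarrow> bool" where
  "universal_dset D \<longleftrightarrow> (\<exists>(M::nat set) d. in_U D M d)"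

text \<open>Katetov function t with domain F (values of t outside F are irrelevant).\<close>
definition katetov :: "real set \<Rightarrow> 'a set \<Rightarrow> ('a \<Rightarrow> 'a \<Rightarrow> real) \<Rightarrow> 'a set \<Rightarrow> ('a \<Rightarrow> real) \<Rightarrow> bool" where
  "katetov D M d F t \<longleftrightarrow> F \<subseteq> M \<and> finite F \<and> (\<forall>x\<in>F. t x \<in> D - {0}) \<and>
     (\<forall>x\<in>F. \<forall>y\<in>F. \<bar>t x - t y\<bar> \<le> d x y \<and> d x y \<le> t x + t y)"

definition orb :: "'a set \<Rightarrow> ('a \<Rightarrow> 'a \<Rightarrow> real) \<Rightarrow> 'a set \<Rightarrow> ('a \<Rightarrow> real) \<Rightarrow> 'a set" where
  "orb M d F t = {y \<in> M - F. \<forall>x\<in>F. d y x = t x}"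

definition kdist :: "'a set \<Rightarrow> ('a \<Rightarrow> 'a \<Rightarrow> real) \<Rightarrow> 'a set \<Rightarrow> ('a \<Rightarrow> real) \<Rightarrow> 'a set \<Rightarrow> ('a \<Rightarrow> real) \<Rightarrow> real set" where
  "kdist M d F s G t = {d x y | x y. x \<in> orb M d F s \<and> y \<in> orb M d G t}"

end

theory Submission
  imports Defs
begin

text \<open>
  Let \<open>N\<close> be the union of \<open>A\<close> and the orbits of the \<open>t i\<close>. The hypothesis on the distances between
  orbits guarantees that adding to \<open>N\<close> a copy of \<open>B\<close>, at the distances prescribed by the \<open>u i\<close>,
  gives a metric space. Amalgamate it with \<open>M\<close> over \<open>N\<close>, where the distance of \<open>x\<close> and \<open>b\<close> is the
  minimum over \<open>n \<in> N\<close> of \<open>d x n \<oplus> d n b\<close> and \<open>a \<oplus> b\<close> is the largest element of \<open>D\<close> below \<open>a + b\<close>.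
  This is a metric because \<open>\<oplus>\<close> is associative: in \<open>M\<close> one finds two triangles glued along an edge.
  The amalgam is countable, so the identity on \<open>A \<union> B\<close> extends point by point to an embedding of
  the amalgam into \<open>M\<close>, and its restriction to \<open>M\<close> is the required map.
\<close>

section \<open>Truncated addition\<close>

definition dplus :: "real set \<Rightarrow> real \<Rightarrow> real \<Rightarrow> real" where
  "dplus D a b = Max {r \<in> D. r \<le> a + b}"

locale distance_set =
  fixes D :: "real set"
  assumes finite_D: "finite D" and zero_D: "0 \<in> D" and nonneg_D: "r \<in> D \<Longrightarrow> 0 \<le> r"
begin

abbreviation dplus_D :: "real \<Rightarrow> real \<Rightarrow> real" (infixl "\<oplus>" 65) where
  "a \<oplus> b \<equiv> dplus D a b"

lemma dplus_mem_le:
  assumes "a \<in> D" "b \<in> D"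
  shows "a \<oplus> b \<in> D" and "a \<oplus> b \<le> a + b"
proof -
  have "0 \<in> {r \<in> D. r \<le> a + b}" using assms zero_D nonneg_D by force
  then have "Max {r \<in> D. r \<le> a + b} \<in> {r \<in> D. r \<le> a + b}"
    using finite_D by (intro Max_in) auto
  then show "a \<oplus> b \<in> D" "a \<oplus> b \<le> a + b" by (auto simp: dplus_def)
qed

lemma le_dplusI: "r \<in> D \<Longrightarrow> r \<le> a + b \<Longrightarrow> r \<le> a \<oplus> b"
  unfolding dplus_def using finite_D by (intro Max_ge) auto

lemma dplus_commute: "a \<oplus> b = b \<oplus> a"
  by (simp add: dplus_def add.commute)

lemma dplus_mono:
  assumes "a \<in> D" "b \<in> D" "a \<le> a'" "b \<le> b'"
  shows "a \<oplus> b \<le> a' \<oplus> b'"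
  using dplus_mem_le[OF assms(1,2)] assms(3,4) by (intro le_dplusI) linarith+

lemma le_dplus:
  assumes "a \<in> D" "b \<in> D"
  shows "a \<le> a \<oplus> b" and "b \<le> a \<oplus> b"
  using assms nonneg_D by (auto intro!: le_dplusI)

lemma zero_dplus: "a \<in> D \<Longrightarrow> 0 \<oplus> a = a"
  using dplus_mem_le[OF zero_D] le_dplus[OF zero_D] by force

lemma dplus_zero: "a \<in> D \<Longrightarrow> a \<oplus> 0 = a"
  by (simp add: zero_dplus dplus_commute)

end

section \<open>Amalgamation\<close>

text \<open>Universality of \<open>D\<close> enters amalgamation through this law, which
  \<open>in_U_associative\<close> derives from a member of the class.\<close>

locale associative_distance_set = distance_set +
  assumes dplus_assoc: "a \<in> D \<Longrightarrow> b \<in> D \<Longrightarrow> c \<in> D \<Longrightarrow> a \<oplus> b \<oplus> c = a \<oplus> (b \<oplus> c)"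

locale amalgam = associative_distance_set D
  for D :: "real set" +
  fixes X Y :: "'b set" and d1 d2 :: "'b \<Rightarrow> 'b \<Rightarrow> real"
  assumes metric1: "metric_on X d1" and metric2: "metric_on Y d2"
    and dist1: "dist_set X d1 \<subseteq> D" and dist2: "dist_set Y d2 \<subseteq> D"
    and meet: "X \<inter> Y \<noteq> {}"
    and agree: "x \<in> X \<inter> Y \<Longrightarrow> y \<in> X \<inter> Y \<Longrightarrow> d1 x y = d2 x y"
begin

definition cross_dist :: "'b \<Rightarrow> 'b \<Rightarrow> real" where
  "cross_dist x y = Min ((\<lambda>n. d1 x n \<oplus> d2 n y) ` (X \<inter> Y))"

lemma dist1_mem: "x \<in> X \<Longrightarrow> y \<in> X \<Longrightarrow> d1 x y \<in> D"
  using dist1 by (auto simp: dist_set_def)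

lemma dist2_mem: "x \<in> Y \<Longrightarrow> y \<in> Y \<Longrightarrow> d2 x y \<in> D"
  using dist2 by (auto simp: dist_set_def)

text \<open>The overlap may be infinite, but all path lengths through it lie in the finite set
  \<open>D\<close>; hence the minimum exists and is attained.\<close>

lemma finite_cross:
  assumes "x \<in> X" "y \<in> Y"
  shows "finite ((\<lambda>n. d1 x n \<oplus> d2 n y) ` (X \<inter> Y))"
  using assms by (intro finite_subset[OF _ finite_D]) (auto intro!: dplus_mem_le dist1_mem dist2_mem)

lemma cross_dist_le:
  assumes "x \<in> X" "y \<in> Y" "n \<in> X \<inter> Y"
  shows "cross_dist x y \<le> d1 x n \<oplus> d2 n y"
  unfolding cross_dist_def using assms finite_cross by (intro Min_le) auto

lemma cross_dist_attained:
  assumes "x \<in> X" "y \<in> Y"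
  obtains n where "n \<in> X" "n \<in> Y" "cross_dist x y = d1 x n \<oplus> d2 n y"
proof -
  have "cross_dist x y \<in> (\<lambda>n. d1 x n \<oplus> d2 n y) ` (X \<inter> Y)"
    unfolding cross_dist_def using assms finite_cross meet by (intro Min_in) auto
  then show ?thesis using that by auto
qed

lemma cross_dist_mem: "x \<in> X \<Longrightarrow> y \<in> Y \<Longrightarrow> cross_dist x y \<in> D"
  by (metis cross_dist_attained dist1_mem dist2_mem dplus_mem_le(1))

lemma sym1: "x \<in> X \<Longrightarrow> y \<in> X \<Longrightarrow> d1 x y = d1 y x"
  using metric1 by (auto simp: metric_on_def)

lemma sym2: "x \<in> Y \<Longrightarrow> y \<in> Y \<Longrightarrow> d2 x y = d2 y x"
  using metric2 by (auto simp: metric_on_def)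

lemma triangle1: "x \<in> X \<Longrightarrow> y \<in> X \<Longrightarrow> z \<in> X \<Longrightarrow> d1 x z \<le> d1 x y \<oplus> d1 y z"
  using metric1 by (intro le_dplusI dist1_mem) (auto simp: metric_on_def)

lemma triangle2: "x \<in> Y \<Longrightarrow> y \<in> Y \<Longrightarrow> z \<in> Y \<Longrightarrow> d2 x z \<le> d2 x y \<oplus> d2 y z"
  using metric2 by (intro le_dplusI dist2_mem) (auto simp: metric_on_def)

text \<open>The path through \<open>n = y\<close> gives one inequality. For the other, any path
  through the overlap lies entirely in \<open>X\<close>, where the triangle inequality bounds it
  below.\<close>

lemma cross_dist_right:
  assumes x: "x \<in> X" and y: "y \<in> X" "y \<in> Y"
  shows "cross_dist x y = d1 x y"
proof (rule antisym)
  have "d2 y y = 0" using metric2 y by (auto simp: metric_on_def)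
  then show "cross_dist x y \<le> d1 x y"
    using cross_dist_le[of x y y] x y dplus_zero dist1_mem by force
next
  obtain n where "n \<in> X" "n \<in> Y" "cross_dist x y = d1 x n \<oplus> d2 n y"
    using cross_dist_attained x y by blast
  then show "d1 x y \<le> cross_dist x y"
    using triangle1[of x n y] agree[of n y] x y by auto
qed

lemma cross_dist_eq_0:
  assumes x: "x \<in> X" and y: "y \<in> Y" and "cross_dist x y = 0"
  shows "x = y"
proof -
  obtain n where n: "n \<in> X" "n \<in> Y" "cross_dist x y = d1 x n \<oplus> d2 n y"
    using cross_dist_attained x y by blast
  have "d1 x n = 0" "d2 n y = 0"
    using le_dplus[of "d1 x n" "d2 n y"] n assms dist1_mem[of x n] dist2_mem[of n y] nonneg_D
    by force+
  then show ?thesis using metric1 metric2 n x y by (auto simp: metric_on_def)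
qed

text \<open>These are the triangles with two corners in \<open>X\<close> and one in
  \<open>Y\<close>; exchanging \<open>X\<close> and \<open>Y\<close> gives the other mixed
  ones.\<close>

lemma cross_dist_triangle:
  assumes x: "x \<in> X" and x': "x' \<in> X" and y: "y \<in> Y"
  shows "cross_dist x y \<le> d1 x x' + cross_dist x' y"
    and "d1 x x' \<le> cross_dist x y + cross_dist x' y"
proof -
  obtain n' where n': "n' \<in> X" "n' \<in> Y" "cross_dist x' y = d1 x' n' \<oplus> d2 n' y"
    using cross_dist_attained x' y by blast
  obtain n where n: "n \<in> X" "n \<in> Y" "cross_dist x y = d1 x n \<oplus> d2 n y"
    using cross_dist_attained x y by blast
  note mem = dist1_mem dist2_mem dplus_mem_le(1) cross_dist_mem
  \<comment> \<open>The point \<open>n'\<close>, optimal for \<open>x'\<close>, is a competitor for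
    \<open>x\<close>; associativity then splits off the leg from \<open>x\<close> to
    \<open>x'\<close>.\<close>
  have "cross_dist x y \<le> d1 x n' \<oplus> d2 n' y"
    using cross_dist_le x y n' by blast
  also have "\<dots> \<le> d1 x x' \<oplus> d1 x' n' \<oplus> d2 n' y"
    using x x' y n' by (intro dplus_mono triangle1 mem order.refl)
  also have "\<dots> = d1 x x' \<oplus> cross_dist x' y"
    using x x' y n' by (simp add: dplus_assoc mem)
  also have "\<dots> \<le> d1 x x' + cross_dist x' y"
    using x x' y by (intro dplus_mem_le mem)
  finally show "cross_dist x y \<le> d1 x x' + cross_dist x' y" .
  \<comment> \<open>Follow the path \<open>x\<close>, \<open>n\<close>, \<open>n'\<close>,
    \<open>x'\<close> in \<open>X\<close>, then detour from \<open>n\<close> to \<open>n'\<close>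
    through \<open>y\<close> in \<open>Y\<close>, which is possible because the metrics agree on the
    overlap. Regrouping the four legs gives the two optimal paths to \<open>y\<close>.\<close>
  have "d1 x x' \<le> d1 x n \<oplus> d1 n x'"
    using x x' n by (intro triangle1)
  also have "\<dots> \<le> d1 x n \<oplus> (d1 n n' \<oplus> d1 n' x')"
    using x x' n n' by (intro dplus_mono triangle1 mem order.refl)
  also have "\<dots> \<le> d1 x n \<oplus> (d2 n y \<oplus> d2 y n' \<oplus> d1 n' x')"
    using x x' y n n' agree[of n n'] triangle2[of n y n']
    by (intro dplus_mono mem order.refl) auto
  also have "\<dots> = cross_dist x y \<oplus> cross_dist x' y"
    using x x' y n n'
    by (simp add: dplus_assoc mem sym1[of n' x'] sym2[of y n'] dplus_commute[of "d1 x' n'"])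
  also have "\<dots> \<le> cross_dist x y + cross_dist x' y"
    using x x' y by (intro dplus_mem_le mem)
  finally show "d1 x x' \<le> cross_dist x y + cross_dist x' y" .
qed

definition amalgam_dist :: "'b \<Rightarrow> 'b \<Rightarrow> real" where
  "amalgam_dist x y =
    (if x \<in> X \<and> y \<in> X then d1 x y else if x \<in> Y \<and> y \<in> Y then d2 x y
     else if x \<in> X then cross_dist x y else cross_dist y x)"

end

text \<open>The assumptions are symmetric in the two spaces, so facts about two points of
  \<open>X\<close> and one of \<open>Y\<close> also hold with the roles exchanged.\<close>

sublocale amalgam \<subseteq> swap: amalgam D Y X d2 d1
  using metric1 metric2 dist1 dist2 meet agree by unfold_locales auto

context amalgam
begin

lemma swap_cross_dist:
  assumes "x \<in> X" "y \<in> Y"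
  shows "swap.cross_dist y x = cross_dist x y"
proof -
  have "(\<lambda>n. d2 y n \<oplus> d1 n x) ` (X \<inter> Y) = (\<lambda>n. d1 x n \<oplus> d2 n y) ` (X \<inter> Y)"
    using assms by (intro image_cong refl) (auto simp: dplus_commute sym1 sym2)
  then show ?thesis by (simp add: cross_dist_def swap.cross_dist_def Int_commute)
qed

lemma cross_dist_left: "x \<in> X \<Longrightarrow> x \<in> Y \<Longrightarrow> y \<in> Y \<Longrightarrow> cross_dist x y = d2 x y"
  using swap.cross_dist_right[of y x] swap_cross_dist[of x y] sym2[of x y] by simp

lemma amalgam_dist_simps:
  shows "x \<in> X \<Longrightarrow> y \<in> X \<Longrightarrow> amalgam_dist x y = d1 x y"
    and "x \<in> Y \<Longrightarrow> y \<in> Y \<Longrightarrow> amalgam_dist x y = d2 x y"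
    and "x \<in> X \<Longrightarrow> y \<in> Y \<Longrightarrow> amalgam_dist x y = cross_dist x y"
    and "x \<in> X \<Longrightarrow> y \<in> Y \<Longrightarrow> amalgam_dist y x = cross_dist x y"
  using agree sym1 sym2 cross_dist_right cross_dist_left by (auto simp: amalgam_dist_def)

lemma metric_amalgam_dist: "metric_on (X \<union> Y) amalgam_dist"
proof -
  have sym: "amalgam_dist x y = amalgam_dist y x" if "x \<in> X \<union> Y" "y \<in> X \<union> Y" for x y
    using that sym1 sym2 by (auto simp: amalgam_dist_simps)
  have zero: "0 \<le> amalgam_dist x y \<and> (amalgam_dist x y = 0 \<longleftrightarrow> x = y)"
    if "x \<in> X \<union> Y" "y \<in> X \<union> Y" for x y
  proof -
    have "amalgam_dist x y = 0 \<longleftrightarrow> x = y" if "x \<in> X" "y \<in> X" for x y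
      using that metric1 by (auto simp: amalgam_dist_simps metric_on_def)
    moreover have "amalgam_dist x y = 0 \<longleftrightarrow> x = y" if "x \<in> Y" "y \<in> Y" for x y
      using that metric2 by (auto simp: amalgam_dist_simps metric_on_def)
    moreover have "amalgam_dist x y = 0 \<longrightarrow> x = y" "amalgam_dist y x = 0 \<longrightarrow> x = y"
      if "x \<in> X" "y \<in> Y" for x y
      using that cross_dist_eq_0 by (auto simp: amalgam_dist_simps)
    moreover have "amalgam_dist x y \<in> D"
      using that by (auto simp: amalgam_dist_simps dist1_mem dist2_mem cross_dist_mem)
    ultimately show ?thesis using that nonneg_D by blast
  qed
  have XXY: "amalgam_dist x y \<le> amalgam_dist x x' + amalgam_dist x' y"
    "amalgam_dist x x' \<le> amalgam_dist x y + amalgam_dist y x'"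
    if "x \<in> X" "x' \<in> X" "y \<in> Y" for x x' y
    using that cross_dist_triangle by (auto simp: amalgam_dist_simps)
  have YYX: "amalgam_dist y x \<le> amalgam_dist y y' + amalgam_dist y' x"
    "amalgam_dist y y' \<le> amalgam_dist y x + amalgam_dist x y'"
    if "y \<in> Y" "y' \<in> Y" "x \<in> X" for x y y'
    using that swap.cross_dist_triangle[of y y' x] by (auto simp: amalgam_dist_simps swap_cross_dist)
  have tri: "amalgam_dist x z \<le> amalgam_dist x y + amalgam_dist y z"
    if "x \<in> X \<union> Y" "y \<in> X \<union> Y" "z \<in> X \<union> Y" for x y z
  proof -
    \<comment> \<open>The six mixed cases are \<open>XXY\<close> and \<open>YYX\<close>, two of them
      after reversing the path from \<open>x\<close> to \<open>z\<close>.\<close>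
    consider "x \<in> X" "y \<in> X" "z \<in> X" | "x \<in> Y" "y \<in> Y" "z \<in> Y"
      | "x \<in> X" "y \<in> X" "z \<in> Y" | "x \<in> X" "y \<in> Y" "z \<in> X" | "x \<in> Y" "y \<in> X" "z \<in> X"
      | "x \<in> Y" "y \<in> Y" "z \<in> X" | "x \<in> Y" "y \<in> X" "z \<in> Y" | "x \<in> X" "y \<in> Y" "z \<in> Y"
      using \<open>x \<in> X \<union> Y\<close> \<open>y \<in> X \<union> Y\<close> \<open>z \<in> X \<union> Y\<close> by blast
    then show ?thesis
    proof cases
      case 1 then show ?thesis using metric1 by (auto simp: amalgam_dist_simps metric_on_def)
    next
      case 2 then show ?thesis using metric2 by (auto simp: amalgam_dist_simps metric_on_def)
    next
      case 3 then show ?thesis by (intro XXY)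
    next
      case 4 then show ?thesis by (intro XXY)
    next
      case 5 then show ?thesis using XXY(1)[of z y x] sym that by (simp add: add.commute)
    next
      case 6 then show ?thesis by (intro YYX)
    next
      case 7 then show ?thesis by (intro YYX)
    next
      case 8 then show ?thesis using YYX(1)[of z y x] sym that by (simp add: add.commute)
    qed
  qed
  show ?thesis unfolding metric_on_def using zero sym tri by blast
qed

lemma dist_set_amalgam_dist: "dist_set (X \<union> Y) amalgam_dist \<subseteq> D"
  by (auto simp: dist_set_def amalgam_dist_simps dist1_mem dist2_mem cross_dist_mem)

end

section \<open>Extending partial isometries\<close>

lemma metric_on_subset: "metric_on M d \<Longrightarrow> N \<subseteq> M \<Longrightarrow> metric_on N d"
  unfolding metric_on_def by (meson subsetD)

lemma dist_set_mono: "N \<subseteq> M \<Longrightarrow> dist_set N d \<subseteq> dist_set M d"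
  unfolding dist_set_def by blast

lemma isometric_emb_inj_on:
  assumes "metric_on M d" "metric_on N e" "isometric_emb M d N e f"
  shows "inj_on f M"
proof (rule inj_onI)
  fix x y assume "x \<in> M" "y \<in> M" "f x = f y"
  moreover have "e (f x) (f y) = d x y" "f x \<in> N" "f y \<in> N"
    using assms(3) \<open>x \<in> M\<close> \<open>y \<in> M\<close> by (auto simp: isometric_emb_def)
  ultimately show "x = y" using assms(1,2) by (metis metric_on_def)
qed

text \<open>Numbering the points of \<open>X\<close> transfers universality from carriers of
  naturals to an arbitrary type.\<close>

lemma isometric_emb_finite:
  fixes X :: "'b set"
  assumes U: "in_U D M d" and "finite X" "metric_on X e" "dist_set X e \<subseteq> D"
  shows "\<exists>f. isometric_emb X e M d f"
proof -
  obtain h where h: "bij_betw h X {0..<card X}"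
    using ex_bij_betw_finite_nat[OF \<open>finite X\<close>] by blast
  define g where "g = the_inv_into X h"
  have gX: "g i \<in> X" if "i \<in> {0..<card X}" for i
    using that h unfolding g_def bij_betw_def by (metis order.refl the_inv_into_into)
  have hg: "h (g i) = i" if "i \<in> {0..<card X}" for i
    using that h unfolding g_def bij_betw_def by (metis f_the_inv_into_f)
  have gh: "g (h x) = x" "h x \<in> {0..<card X}" if "x \<in> X" for x
    using that h unfolding g_def bij_betw_def by (auto simp: the_inv_into_f_f)
  have "metric_on {0..<card X} (\<lambda>i j. e (g i) (g j))"
    unfolding metric_on_def
  proof (intro conjI ballI)
    fix i j assume ij: "i \<in> {0..<card X}" "j \<in> {0..<card X}"
    show "0 \<le> e (g i) (g j)" "e (g i) (g j) = e (g j) (g i)"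
      using assms(3) gX[OF ij(1)] gX[OF ij(2)] by (auto simp: metric_on_def)
    show "e (g i) (g j) = 0 \<longleftrightarrow> i = j"
      using assms(3) gX[OF ij(1)] gX[OF ij(2)] hg[OF ij(1)] hg[OF ij(2)] by (metis metric_on_def)
  next
    fix i j k assume "i \<in> {0..<card X}" "j \<in> {0..<card X}" "k \<in> {0..<card X}"
    then show "e (g i) (g k) \<le> e (g i) (g j) + e (g j) (g k)"
      using assms(3) gX by (meson metric_on_def)
  qed
  moreover have "dist_set {0..<card X} (\<lambda>i j. e (g i) (g j)) \<subseteq> D"
    using assms(4) gX by (fastforce simp: dist_set_def)
  ultimately obtain f where "isometric_emb {0..<card X} (\<lambda>i j. e (g i) (g j)) M d f"
    using U unfolding in_U_def universal_for_def by (metis finite_atLeastLessThan)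
  then have "isometric_emb X e M d (f \<circ> h)"
    using gh by (auto simp: isometric_emb_def)
  then show ?thesis by blast
qed

text \<open>Universality embeds the enlarged space somewhere in \<open>M\<close>, by
  \<open>h\<close>; homogeneity supplies an isometry of \<open>M\<close> that carries
  \<open>h\<close> to \<open>f\<close> on \<open>S\<close>.\<close>

lemma isometric_emb_insert:
  fixes S :: "'b set"
  assumes U: "in_U D M d" and S: "finite S" "metric_on (insert x S) e" "dist_set (insert x S) e \<subseteq> D"
    and f: "isometric_emb S e M d f"
  shows "\<exists>f'. isometric_emb (insert x S) e M d f' \<and> (\<forall>z\<in>S. f' z = f z)"
proof -
  have M: "metric_on M d" using U by (simp add: in_U_def)
  have mS: "metric_on S e" using S(2) by (rule metric_on_subset) auto
  obtain h where h: "isometric_emb (insert x S) e M d h"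
    using isometric_emb_finite[OF U _ S(2,3)] S(1) by blast
  have hS: "isometric_emb S e M d h" using h by (auto simp: isometric_emb_def)
  have injh: "inj_on h S" by (rule isometric_emb_inj_on[OF mS M hS])
  have injf: "inj_on f S" by (rule isometric_emb_inj_on[OF mS M f])
  \<comment> \<open>The finite partial isometry sending each \<open>h z\<close> to
    \<open>f z\<close>, to be extended by homogeneity.\<close>
  define p where "p = f \<circ> the_inv_into S h"
  have ph: "p (h z) = f z" if "z \<in> S" for z
    using that injh by (simp add: p_def the_inv_into_f_f)
  have bij: "bij_betw p (h ` S) (f ` S)"
    unfolding p_def
    by (intro bij_betw_trans[OF bij_betw_the_inv_into] inj_on_imp_bij_betw injh injf)
  have iso: "\<forall>z\<in>h ` S. \<forall>w\<in>h ` S. d (p z) (p w) = d z w"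
    using ph f hS by (simp add: isometric_emb_def)
  have sub: "h ` S \<subseteq> M" "f ` S \<subseteq> M" using f hS by (simp_all add: isometric_emb_def)
  have "homogeneous M d" using U by (simp add: in_U_def)
  from this[unfolded homogeneous_def, rule_format, OF conjI[OF sub(1) conjI[OF sub(2)
      conjI[OF finite_imageI[OF S(1)] conjI[OF bij iso]]]]]
  obtain g where g: "bij_betw g M M" "\<forall>z\<in>M. \<forall>w\<in>M. d (g z) (g w) = d z w"
      "\<forall>z\<in>h ` S. g z = p z"
    by (elim exE conjE)
  have "isometric_emb (insert x S) e M d (g \<circ> h)"
    using h g(2) bij_betwE[OF g(1)] unfolding isometric_emb_def
    by (auto simp: image_subset_iff)
  moreover have "\<forall>z\<in>S. (g \<circ> h) z = f z" using g(3) ph by auto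
  ultimately show ?thesis by blast
qed

text \<open>One-point extensions along an enumeration of \<open>P\<close> form a chain of
  embeddings, and their union is the required map.\<close>

lemma isometric_emb_countable_extend:
  fixes P S :: "'b set"
  assumes U: "in_U D M d" and P: "countable P" "metric_on P e" "dist_set P e \<subseteq> D"
    and S: "finite S" "S \<subseteq> P" and f: "isometric_emb S e M d f"
  shows "\<exists>g. isometric_emb P e M d g \<and> (\<forall>z\<in>S. g z = f z)"
proof (cases "P = {}")
  case True
  then show ?thesis using f S(2) by (intro exI[of _ f]) simp
next
  case False
  \<comment> \<open>The enumeration may repeat points or meet \<open>S\<close>; such a stage inserts
    a point already present, which \<open>isometric_emb_insert\<close> allows.\<close>
  define xs where "xs = from_nat_into P"
  have xs: "range xs = P" unfolding xs_def using False P(1) by (rule range_from_nat_into)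
  define T where "T n = S \<union> xs ` {..<n}" for n
  have T: "finite (T n)" "T n \<subseteq> P" "T (Suc n) = insert (xs n) (T n)" for n
    using S xs by (auto simp: T_def lessThan_Suc)
  have T_mono: "T m \<subseteq> T n" if "m \<le> n" for m n
    using that by (auto simp: T_def)
  have "\<exists>F. \<forall>n. (isometric_emb (T n) e M d (F n) \<and> (\<forall>z\<in>S. F n z = f z)) \<and>
      (\<forall>z\<in>T n. F (Suc n) z = F n z)"
  proof (rule dependent_nat_choice)
    show "\<exists>h. isometric_emb (T 0) e M d h \<and> (\<forall>z\<in>S. h z = f z)"
      using f by (auto simp: T_def)
  next
    fix h n assume h: "isometric_emb (T n) e M d h \<and> (\<forall>z\<in>S. h z = f z)"
    have "metric_on (insert (xs n) (T n)) e" "dist_set (insert (xs n) (T n)) e \<subseteq> D"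
      using metric_on_subset[OF P(2) T(2)[of "Suc n"]] dist_set_mono[OF T(2)[of "Suc n"]] P(3)
      by (auto simp: T(3))
    from isometric_emb_insert[OF U T(1) this conjunct1[OF h]]
    obtain h' where h': "isometric_emb (T (Suc n)) e M d h'" "\<forall>z\<in>T n. h' z = h z"
      unfolding T(3) by (elim exE conjE)
    have "\<forall>z\<in>S. h' z = f z" using h h'(2) by (simp add: T_def)
    with h' show "\<exists>h'. (isometric_emb (T (Suc n)) e M d h' \<and> (\<forall>z\<in>S. h' z = f z)) \<and>
        (\<forall>z\<in>T n. h' z = h z)"
      by (intro exI[of _ h'] conjI)
  qed
  then obtain F where "\<forall>n. (isometric_emb (T n) e M d (F n) \<and> (\<forall>z\<in>S. F n z = f z)) \<and>
      (\<forall>z\<in>T n. F (Suc n) z = F n z)"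
    by (elim exE)
  then have F: "isometric_emb (T n) e M d (F n)" "z \<in> S \<Longrightarrow> F n z = f z"
      "z \<in> T n \<Longrightarrow> F (Suc n) z = F n z" for n z
    by simp_all
  have F_mono: "F n z = F m z" if "m \<le> n" "z \<in> T m" for m n z
    using that(1)
  proof (induction n rule: dec_induct)
    case (step n)
    then show ?case using F(3) T_mono[of m n] that(2) by auto
  qed simp
  \<comment> \<open>The limit map takes its value at \<open>z\<close> from the first stage
    containing \<open>z\<close>; by \<open>F_mono\<close> all later stages agree with it.\<close>
  define k where "k z = (LEAST n. z \<in> T n)" for z
  define g where "g z = F (k z) z" for z
  have ex: "\<exists>n. z \<in> T n" if "z \<in> P" for z
    using that xs T(3) by (metis imageE insertI1)
  have k: "z \<in> T (k z)" if "z \<in> P" for z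
    unfolding k_def using ex[OF that] by (rule LeastI_ex)
  have "g z \<in> M" if "z \<in> P" for z
    using F(1)[of "k z"] k[OF that] by (auto simp: isometric_emb_def g_def)
  moreover have "d (g z) (g w) = e z w" if "z \<in> P" "w \<in> P" for z w
  proof -
    define n where "n = max (k z) (k w)"
    have "z \<in> T n" "w \<in> T n" using k that T_mono[of "k z" n] T_mono[of "k w" n] by (auto simp: n_def)
    moreover have "g z = F n z" "g w = F n w"
      unfolding g_def n_def by (intro F_mono[symmetric] max.cobounded1 max.cobounded2 k that)+
    ultimately show ?thesis using F(1)[of n] by (auto simp: isometric_emb_def)
  qed
  ultimately have "isometric_emb P e M d g" by (auto simp: isometric_emb_def)
  moreover have "\<forall>z\<in>S. g z = f z" using F(2) by (simp add: g_def)
  ultimately show ?thesis by blast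
qed

section \<open>Associativity of truncated addition\<close>

lemma triangle_realized:
  assumes U: "in_U D M d" and pos: "\<forall>r\<in>D. 0 \<le> r" and p: "p \<in> M" and q: "q \<in> M"
    and ab: "a \<in> D" "b \<in> D" "\<bar>a - b\<bar> \<le> d p q" "d p q \<le> a + b"
  shows "\<exists>v\<in>M. d v p = a \<and> d v q = b"
proof (cases "a = 0 \<or> b = 0")
  case True
  have "d p p = 0" "d q q = 0" "d p q = d q p"
    using U p q by (auto simp: in_U_def metric_on_def)
  \<comment> \<open>If one prescribed distance is 0, the bounds force the other to be
    \<open>d p q\<close>, so an endpoint serves as \<open>v\<close>.\<close>
  then show ?thesis using True ab p q by (intro bexI[of _ "if a = 0 then p else q"]) auto
next
  case False
  then have ab_pos: "0 < a" "0 < b" using pos ab by force+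
  have M: "metric_on M d" and D: "dist_set M d = D" using U by (auto simp: in_U_def)
  have M0: "d p p = 0" "d q q = 0" "d q p = d p q" "0 \<le> d p q" "d p q = 0 \<longleftrightarrow> p = q"
    using M p q by (auto simp: metric_on_def)
  \<comment> \<open>If \<open>p = q\<close>, the bounds give \<open>a = b\<close>, so
    \<open>c q = b\<close> holds in that case too. In \<open>e\<close> the new point is
    \<open>None\<close>, and \<open>c\<close> gives its distances to \<open>p\<close> and
    \<open>q\<close>.\<close>
  define c where "c x = (if x = p then a else b)" for x
  have c: "c p = a" "c q = b"
    using ab M0 by (auto simp: c_def)
  define e where "e x y = (case (x, y) of (None, None) \<Rightarrow> 0 | (Some x, None) \<Rightarrow> c x
      | (None, Some y) \<Rightarrow> c y | (Some x, Some y) \<Rightarrow> d x y)" for x y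
  let ?S = "{Some p, Some q}"
  have "metric_on (insert None ?S) e"
    unfolding metric_on_def using M0 ab ab_pos c by (auto simp: e_def)
  moreover have "dist_set (insert None ?S) e \<subseteq> D"
    using D p q U ab c M0 by (force simp: dist_set_def e_def)
  moreover have "isometric_emb ?S e M d the"
    using p q by (auto simp: isometric_emb_def e_def)
  ultimately obtain f where f: "isometric_emb (insert None ?S) e M d f" "\<forall>z\<in>?S. f z = the z"
    using isometric_emb_insert[OF U, of ?S None e the] by auto
  have "f None \<in> M" "d (f None) (f (Some p)) = e None (Some p)" "d (f None) (f (Some q)) = e None (Some q)"
    using f(1) by (auto simp: isometric_emb_def)
  then show ?thesis using f(2) c by (auto simp: e_def)
qed

text \<open>Triangles with sides \<open>m\<close>, \<open>a\<close>, \<open>b\<close> and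
  \<open>m\<close>, \<open>r\<close>, \<open>c\<close> are glued in \<open>M\<close> along the edge
  of length \<open>m\<close>. The distance of their apexes \<open>v\<close> and \<open>w\<close> is
  in \<open>D\<close>, at most \<open>b + c\<close> via \<open>q\<close>, and together with
  \<open>a\<close> it bounds \<open>r\<close> via \<open>p\<close>.\<close>

lemma in_U_associative:
  assumes U: "in_U D M d" and D: "finite D" "0 \<in> D" "\<forall>r\<in>D. 0 \<le> r"
  shows "associative_distance_set D"
proof -
  interpret distance_set D using D by unfold_locales auto
  have M: "metric_on M d" and dM: "dist_set M d = D" using U by (auto simp: in_U_def)
  have half: "a \<oplus> b \<oplus> c \<le> a \<oplus> (b \<oplus> c)" if abc: "a \<in> D" "b \<in> D" "c \<in> D" for a b c
  proof -
    define m where "m = a \<oplus> b"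
    define r where "r = m \<oplus> c"
    have m: "m \<in> D" "m \<le> a + b" "a \<le> m" "b \<le> m"
      unfolding m_def using abc dplus_mem_le le_dplus by blast+
    have r: "r \<in> D" "r \<le> m + c" "m \<le> r" "c \<le> r"
      unfolding r_def using abc m dplus_mem_le le_dplus by blast+
    have nonneg: "0 \<le> a" "0 \<le> b" "0 \<le> c" using nonneg_D abc by auto
    obtain p q where pq: "p \<in> M" "q \<in> M" "d p q = m"
      using m(1) dM by (auto simp: dist_set_def)
    have "\<bar>a - b\<bar> \<le> d p q" "d p q \<le> a + b" "\<bar>r - c\<bar> \<le> d p q" "d p q \<le> r + c"
      using pq(3) m r nonneg by linarith+
    then obtain v w where v: "v \<in> M" "d v p = a" "d v q = b"
        and w: "w \<in> M" "d w p = r" "d w q = c"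
      using triangle_realized[OF U D(3) pq(1,2)] abc r(1) by meson
    have "d v w \<in> D" using v w dM by (auto simp: dist_set_def)
    moreover have "d v w \<le> b + c" "r \<le> a + d v w"
      using M pq v w unfolding metric_on_def by (metis add.commute)+
    ultimately have "d v w \<le> b \<oplus> c" "r \<le> a + d v w" by (auto intro: le_dplusI)
    then have "r \<le> a \<oplus> (b \<oplus> c)" using r(1) by (intro le_dplusI) auto
    then show ?thesis by (simp add: r_def m_def)
  qed
  show ?thesis
  proof (unfold_locales, rule antisym)
    fix a b c assume abc: "a \<in> D" "b \<in> D" "c \<in> D"
    show "a \<oplus> b \<oplus> c \<le> a \<oplus> (b \<oplus> c)" using half abc by blast
    \<comment> \<open>By commutativity this is the inequality just proved, for the reversed
      triple.\<close>
    show "a \<oplus> (b \<oplus> c) \<le> a \<oplus> b \<oplus> c"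
      using half[of c b a] abc by (simp add: dplus_commute)
  qed
qed

section \<open>The embedding\<close>

theorem theorem5p1:
  fixes D :: "real set" and M :: "'a set" and d :: "'a \<Rightarrow> 'a \<Rightarrow> real"
    and A B :: "'a set" and s :: nat
    and t u :: "nat \<Rightarrow> 'a \<Rightarrow> real"
  assumes "finite D" and "0 \<in> D" and "\<forall>r\<in>D. 0 \<le> r"
    and "universal_dset D"
    and "in_U D M d"
    and "A \<subseteq> M" and "B \<subseteq> M" and "finite A" and "finite B" and "A \<inter> B = {}"
    and "\<forall>i<s. katetov D M d A (t i)"
    and "\<forall>i<s. katetov D M d (A \<union> B) (u i)"
    and "\<forall>i<s. \<forall>x\<in>A. u i x = t i x"
    and "\<forall>i<s. \<forall>j<s. kdist M d A (t i) A (t j) = kdist M d (A \<union> B) (u i) (A \<union> B) (u j)"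
  shows "\<exists>\<alpha>. isometric_emb M d M d \<alpha> \<and> (\<forall>x\<in>A. \<alpha> x = x) \<and>
           (\<forall>i<s. \<forall>x\<in>orb M d A (t i). \<alpha> x \<in> orb M d (A \<union> B) (u i))"
proof (cases "\<forall>i<s. orb M d A (t i) = {}")
  \<comment> \<open>The orbit condition is vacuous here, so the identity works. Otherwise
    \<open>N\<close> is nonempty even if \<open>A\<close> is empty, as amalgamation over
    \<open>N\<close> requires.\<close>
  case True
  then show ?thesis by (intro exI[of _ id]) (auto simp: isometric_emb_def)
next
  case False
  have U: "in_U D M d" by fact
  have M: "metric_on M d" and dM: "dist_set M d = D" and cM: "countable M"
    using U by (auto simp: in_U_def)
  have zero: "d x y = 0 \<longleftrightarrow> x = y" and nonneg: "0 \<le> d x y" and sym: "d x y = d y x"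
    if "x \<in> M" "y \<in> M" for x y
    using M that by (auto simp: metric_on_def)
  have tri: "d x z \<le> d x y + d y z" if "x \<in> M" "y \<in> M" "z \<in> M" for x y z
    using M that by (auto simp: metric_on_def)
  have mem: "d x y \<in> D" if "x \<in> M" "y \<in> M" for x y
    using that dM by (auto simp: dist_set_def)

  \<comment> \<open>Distances between \<open>N\<close> and the copy of \<open>B\<close>\<close>
  define N where "N = A \<union> (\<Union>i<s. orb M d A (t i))"
  have N: "N \<subseteq> M" "A \<subseteq> N" "N \<noteq> {}"
    using False \<open>A \<subseteq> M\<close> by (auto simp: N_def orb_def)
  \<comment> \<open>The hypothesis on distances between orbits enters here. Taking
    \<open>x = y\<close> and \<open>i = j\<close> also yields a point in the orbit of
    \<open>u i\<close>.\<close>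
  have realize: "\<exists>x'\<in>orb M d (A \<union> B) (u i). \<exists>y'\<in>orb M d (A \<union> B) (u j). d x' y' = d x y"
    if "i < s" "j < s" "x \<in> orb M d A (t i)" "y \<in> orb M d A (t j)" for i j x y
  proof -
    have "d x y \<in> kdist M d A (t i) A (t j)" using that by (auto simp: kdist_def)
    then have "d x y \<in> kdist M d (A \<union> B) (u i) (A \<union> B) (u j)" using assms(14) that by blast
    then show ?thesis by (force simp: kdist_def)
  qed
  \<comment> \<open>The intended distance from \<open>x\<close> in \<open>N\<close> to the copy of
    \<open>b\<close>. The index is an arbitrary choice; \<open>w_orb\<close> shows that the value
    does not depend on it.\<close>
  define w where "w x b = (if x \<in> A then d x b else u (SOME i. i < s \<and> x \<in> orb M d A (t i)) b)"
    for x b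
  have w_orb: "w x b = u i b" if i: "i < s" "x \<in> orb M d A (t i)" and b: "b \<in> B" for i x b
  proof -
    \<comment> \<open>A point in two orbits makes \<open>0\<close> a distance between the corresponding orbits of \<open>u i\<close> and \<open>u j\<close>.\<close>
    define j where "j = (SOME i. i < s \<and> x \<in> orb M d A (t i))"
    have "j < s \<and> x \<in> orb M d A (t j)" unfolding j_def by (rule someI[of _ i]) (use i in auto)
    then obtain x' y' where "x' \<in> orb M d (A \<union> B) (u i)" "y' \<in> orb M d (A \<union> B) (u j)"
        "d x' y' = d x x"
      using realize i by blast
    moreover from this have "x' = y'" using i(2) zero[of x x] zero[of x' y'] by (auto simp: orb_def)
    ultimately have "u i b = u j b" using b by (auto simp: orb_def)
    then show ?thesis using i by (auto simp: w_def j_def orb_def)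
  qed
  \<comment> \<open>A triangle with corners in both \<open>N\<close> and \<open>B\<close> has at
    most two corners in \<open>N\<close>. Hence replacing pairs from \<open>N\<close> by points of
    \<open>M\<close> with true distances \<open>w\<close> to \<open>B\<close> yields every mixed
    triangle inequality; staying outside \<open>B\<close> yields positivity.\<close>
  have pair: "\<exists>x'\<in>M - B. \<exists>y'\<in>M - B. d x' y' = d x y \<and> (\<forall>b\<in>B. d x' b = w x b \<and> d y' b = w y b)"
    if "x \<in> N" "y \<in> N" for x y
  proof -
    \<comment> \<open>The point \<open>x\<close> of \<open>A\<close> stays fixed; any point in the
      orbit of \<open>u j\<close> replaces \<open>y\<close>, because \<open>u j\<close> agrees with
      \<open>t j\<close> at \<open>x\<close>.\<close>
    have orb_A: "\<exists>y'\<in>M - B. d x y' = d x y \<and> (\<forall>b\<in>B. d y' b = w y b)"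
      if x: "x \<in> A" and y: "j < s" "y \<in> orb M d A (t j)" for x y j
    proof -
      obtain y' where y': "y' \<in> orb M d (A \<union> B) (u j)"
        using realize[of j j y y] y by blast
      have "d y' x = d y x" using y' that assms(13) by (auto simp: orb_def)
      then have "d x y' = d x y" using sym[of x y'] sym[of x y] x y y' \<open>A \<subseteq> M\<close> by (auto simp: orb_def)
      moreover have "y' \<in> M - B" "\<forall>b\<in>B. d y' b = w y b"
        using y' that w_orb by (auto simp: orb_def)
      ultimately show ?thesis by blast
    qed
    have A_M: "x \<in> M - B" if "x \<in> A" for x using that \<open>A \<subseteq> M\<close> \<open>A \<inter> B = {}\<close> by blast
    have w_A: "d x b = w x b" if "x \<in> A" for x b using that by (simp add: w_def)
    consider "x \<in> A" "y \<in> A" | j where "x \<in> A" "j < s" "y \<in> orb M d A (t j)"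
      | i where "y \<in> A" "i < s" "x \<in> orb M d A (t i)"
      | i j where "i < s" "x \<in> orb M d A (t i)" "j < s" "y \<in> orb M d A (t j)"
      using \<open>x \<in> N\<close> \<open>y \<in> N\<close> by (auto simp: N_def)
    then show ?thesis
    proof cases
      case 1 then show ?thesis using A_M w_A by blast
    next
      case 2 then show ?thesis using A_M w_A orb_A by blast
    next
      case (3 i)
      then obtain x' where x': "x' \<in> M - B" "d y x' = d y x" "\<forall>b\<in>B. d x' b = w x b"
        using orb_A by blast
      then have "d x' y = d x y" using sym N that by (metis DiffD1 subsetD)
      then show ?thesis using x' 3 A_M w_A by blast
    next
      case (4 i j)
      then obtain x' y' where "x' \<in> orb M d (A \<union> B) (u i)" "y' \<in> orb M d (A \<union> B) (u j)"
          "d x' y' = d x y" using realize by blast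
      moreover from this have "x' \<in> M - B" "y' \<in> M - B"
          "\<forall>b\<in>B. d x' b = w x b" "\<forall>b\<in>B. d y' b = w y b"
        using w_orb 4 by (auto simp: orb_def)
      ultimately show ?thesis by blast
    qed
  qed
  have w_pos: "0 < w x b" and w_mem: "w x b \<in> D" if xb: "x \<in> N" "b \<in> B" for x b
  proof -
    obtain x' where "x' \<in> M" "x' \<noteq> b" "d x' b = w x b" using pair[of x x] xb by blast
    then show "0 < w x b" "w x b \<in> D"
      using zero[of x' b] nonneg[of x' b] mem[of x' b] that \<open>B \<subseteq> M\<close> by auto
  qed
  have w_tri1: "d x y \<le> w x b + w y b" "w x b \<le> d x y + w y b" "w y b \<le> w x b + d x y"
    if xyb: "x \<in> N" "y \<in> N" "b \<in> B" for x y b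
  proof -
    obtain x' y' where "x' \<in> M" "y' \<in> M" "d x' y' = d x y" "d x' b = w x b" "d y' b = w y b"
      using pair xyb by blast
    moreover have "b \<in> M" using that \<open>B \<subseteq> M\<close> by blast
    ultimately show "d x y \<le> w x b + w y b" "w x b \<le> d x y + w y b" "w y b \<le> w x b + d x y"
      using tri[of x' b y'] tri[of x' y' b] tri[of y' x' b] sym[of b y'] sym[of y' x'] by auto
  qed
  have w_tri2: "w x b \<le> w x c + d c b" "w x b \<le> d b c + w x c" "d b c \<le> w x b + w x c"
    if xbc: "x \<in> N" "b \<in> B" "c \<in> B" for x b c
  proof -
    obtain x' where "x' \<in> M" "d x' b = w x b" "d x' c = w x c"
      using pair[of x x] xbc by blast
    moreover have "b \<in> M" "c \<in> M" using that \<open>B \<subseteq> M\<close> by auto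
    ultimately show "w x b \<le> w x c + d c b" "w x b \<le> d b c + w x c" "d b c \<le> w x b + w x c"
      using tri[of x' c b] tri[of b x' c] sym[of b x'] sym[of b c] by auto
  qed

  \<comment> \<open>The two spaces to be amalgamated\<close>
  define d1 :: "'a + 'a \<Rightarrow> 'a + 'a \<Rightarrow> real" where "d1 x y = d (projl x) (projl y)" for x y
  define d2 :: "'a + 'a \<Rightarrow> 'a + 'a \<Rightarrow> real" where
    "d2 x y = (case (x, y) of (Inl x, Inl y) \<Rightarrow> d x y | (Inl x, Inr b) \<Rightarrow> w x b
      | (Inr b, Inl x) \<Rightarrow> w x b | (Inr b, Inr c) \<Rightarrow> d b c)" for x y
  have d2: "d2 (Inl x) (Inl y) = d x y" "d2 (Inl x) (Inr b) = w x b" "d2 (Inr b) (Inl x) = w x b"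
    "d2 (Inr b) (Inr c) = d b c" for x y b c
    by (auto simp: d2_def)
  \<comment> \<open>The sum type keeps the new copy of \<open>B\<close> apart from the points of
    \<open>B\<close> in \<open>M\<close>, so the overlap is exactly the image of
    \<open>N\<close>.\<close>
  let ?X = "Inl ` M :: ('a + 'a) set" and ?Y = "Inl ` N \<union> Inr ` B :: ('a + 'a) set"
  have metric1: "metric_on ?X d1"
    unfolding metric_on_def using zero nonneg sym tri by (auto simp: d1_def)
  have sym2: "d2 x y = d2 y x" if "x \<in> ?Y" "y \<in> ?Y" for x y
    using that N(1) \<open>B \<subseteq> M\<close>
    by (elim UnE imageE) (simp_all add: d2 sym subset_iff)
  have zero2: "0 \<le> d2 x y \<and> (d2 x y = 0 \<longleftrightarrow> x = y)" if "x \<in> ?Y" "y \<in> ?Y" for x y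
    using that
  proof (elim UnE imageE, goal_cases)
    case 1 then show ?case using N(1) nonneg zero by (simp add: d2 subset_iff)
  next
    case (2 a b) then show ?case using w_pos[of a b] by (simp add: d2)
  next
    case (3 b a) then show ?case using w_pos[of a b] by (simp add: d2)
  next
    case 4 then show ?case using \<open>B \<subseteq> M\<close> nonneg zero by (simp add: d2 subset_iff)
  qed
  \<comment> \<open>Of the eight cases, the first lies in \<open>N\<close> and the last in
    \<open>B\<close>; the six mixed ones are \<open>w_tri1\<close> and
    \<open>w_tri2\<close>.\<close>
  have tri2: "d2 x z \<le> d2 x y + d2 y z" if "x \<in> ?Y" "y \<in> ?Y" "z \<in> ?Y" for x y z
    using that
  proof (elim UnE imageE, goal_cases)
    case 1 then show ?case using N(1) by (auto simp: d2 intro: tri)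
  next
    case 8 then show ?case using \<open>B \<subseteq> M\<close> by (auto simp: d2 intro: tri)
  qed (simp_all add: d2 w_tri1 w_tri2)
  have metric2: "metric_on ?Y d2"
    unfolding metric_on_def
    by (intro conjI ballI zero2[THEN conjunct1] zero2[THEN conjunct2] sym2 tri2)
  interpret associative_distance_set D
    by (rule in_U_associative[OF U]) fact+
  interpret amalgam D ?X ?Y d1 d2
  proof
    show "dist_set ?X d1 \<subseteq> D" using mem by (auto simp: dist_set_def d1_def)
    have "d2 x y \<in> D" if "x \<in> ?Y" "y \<in> ?Y" for x y
      using that N(1) \<open>B \<subseteq> M\<close>
      by (elim UnE imageE) (simp_all add: d2 mem w_mem subset_iff)
    then show "dist_set ?Y d2 \<subseteq> D" unfolding dist_set_def by blast
    show "?X \<inter> ?Y \<noteq> {}" using N by auto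
    show "d1 x y = d2 x y" if "x \<in> ?X \<inter> ?Y" "y \<in> ?X \<inter> ?Y" for x y
      using that by (auto simp: d1_def d2)
  qed fact+

  \<comment> \<open>Embedding the amalgam over \<open>A\<close> and the copy of
    \<open>B\<close>\<close>
  let ?S = "Inl ` A \<union> Inr ` B :: ('a + 'a) set"
  have S: "finite ?S" "?S \<subseteq> ?Y" using assms(8,9) N by auto
  \<comment> \<open>The copy of \<open>B\<close> is sent onto \<open>B\<close> itself. This is
    isometric because \<open>w\<close> is the true distance on \<open>A\<close>.\<close>
  have "isometric_emb ?S amalgam_dist M d (case_sum id id)"
  proof -
    have "d (case_sum id id x) (case_sum id id y) = d2 x y" if "x \<in> ?S" "y \<in> ?S" for x y
      using that \<open>A \<subseteq> M\<close> \<open>B \<subseteq> M\<close> by (auto simp: d2 w_def intro!: sym)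
    then show ?thesis
      using S(2) \<open>A \<subseteq> M\<close> \<open>B \<subseteq> M\<close> unfolding isometric_emb_def
      by (auto simp: amalgam_dist_simps(2) subset_iff)
  qed
  moreover have "countable (?X \<union> ?Y)"
    using cM N(1) assms(9) by (auto intro: countable_subset countable_finite)
  ultimately obtain f where f: "isometric_emb (?X \<union> ?Y) amalgam_dist M d f"
      "\<forall>z\<in>?S. f z = case_sum id id z"
    using isometric_emb_countable_extend[OF U _ metric_amalgam_dist dist_set_amalgam_dist S(1)] S(2)
    by blast
  have fA: "f (Inl a) = a" if "a \<in> A" for a using f(2) that by auto
  have fB: "f (Inr b) = b" if "b \<in> B" for b using f(2) that by auto
  have fM: "f (Inl x) \<in> M" if "x \<in> M" for x using f(1) that by (auto simp: isometric_emb_def)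
  have fd: "d (f (Inl x)) (f (Inl y)) = d x y" if "x \<in> M" "y \<in> M" for x y
    using f(1) that by (auto simp: isometric_emb_def amalgam_dist_simps d1_def)
  have fw: "d (f (Inl x)) b = w x b" if "x \<in> N" "b \<in> B" for x b
  proof -
    have "d (f (Inl x)) (f (Inr b)) = amalgam_dist (Inl x) (Inr b)"
      using f(1) that by (auto simp: isometric_emb_def)
    then show ?thesis using that fB by (simp add: amalgam_dist_simps(2) d2)
  qed
  have "f (Inl x) \<in> orb M d (A \<union> B) (u i)" if i: "i < s" and x: "x \<in> orb M d A (t i)" for i x
  proof -
    have xN: "x \<in> N" "x \<in> M" "x \<notin> A" using i x by (auto simp: N_def orb_def)
    have dist_A: "d (f (Inl x)) a = d x a" if "a \<in> A" for a
      using fd[of x a] fA that xN \<open>A \<subseteq> M\<close> by auto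
    \<comment> \<open>An orbit excludes the domain of its function: the image has positive distance
      from \<open>A\<close> because \<open>x\<close> is not in \<open>A\<close>, and from
      \<open>B\<close> by \<open>w_pos\<close>.\<close>
    have "f (Inl x) \<noteq> z" if "z \<in> A \<union> B" for z
      using that dist_A[of z] fw[of x z] w_pos[of x z] xN zero[of x z] zero[of z z] \<open>A \<subseteq> M\<close> \<open>B \<subseteq> M\<close>
      by auto
    then show ?thesis
      using dist_A fw[OF xN(1)] w_orb[OF i x] fM xN x assms(13) i by (auto simp: orb_def)
  qed
  moreover have "isometric_emb M d M d (f \<circ> Inl)"
    using fM fd by (auto simp: isometric_emb_def)
  ultimately show ?thesis using fA by (intro exI[of _ "f \<circ> Inl"]) auto
qed

end
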